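(* Let $n\ge2$, let $h$ and $\omega=\partial_yh$ satisfy Assumption A (see context) on the bounded domain $D\subset\mathbb R^n$, and fix $K_2\ge K_1\ge2$ and $\alpha>0$. Then the domain $D$ can be covered by three sets $D^i\subseteq D$, $$D=D^0\cup D^1\cup D^2,$$ so that the following holds. (i) $D^0$ is $(\alpha/2,K_1)$ completely non-resonant (i.e., non-resonant modulo $\{0\}$), namely, $$y\in D^0\ \Longrightarrow\ |\omega(y)\cdot k|\ge\alpha/2\quad\forall\,k\in\mathbb Z^n,\ 0<|k|_1\le K_1.$$ (ii) $D^1=\bigcup_{k\in\mathcal G^n_{1,K_1}}D^{1,k}$, where, for each $k\in\mathcal G^n_{1,K_1}$, $D^{1,k}$ is a neighbourhood of a simple resonance $\{y\in D:\omega(y)\cdot k=0\}$, which is $(2\alpha K_2/|k|,K_2)$ non-resonant modulo $\mathbb Zk$, namely, $$y\in D^{1,k}\ \Longrightarrow\ |\omega(y)\cdot\ell|\ge 2\alpha K_2/|k|\quad\forall\,\ell\in\mathbb Z^n,\ \ell\notin\mathbb Zk,\ |\ell|_1\le K_2.$$ (iii) $D^2$ contains all the resonances of order two or more and has Lebesgue measure small with $\alpha^2$: more precisely, there exists a constant $c>0$ depending only on $n$ such that $$\mathrm{meas}(D^2)\le c\,\bar L^nM^{n-2}\,\alpha^2\,K_2^{n+1}K_1^{n-1}.$$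
   Context: $|\cdot|$ is the Euclidean norm, $|k|_1=\sum_i|k_i|$, and meas is Lebesgue measure. $\mathbb Z^n_*$ is the set of $k\in\mathbb Z^n\setminus\{0\}$ whose first nonzero component is positive; $\mathcal G^n_1=\{k\in\mathbb Z^n_*:\gcd(k_1,\dots,k_n)=1\}$ (the generators of one-dimensional maximal lattices); $\mathcal G^n_{1,K}=\mathcal G^n_1\cap\{|k|_1\le K\}$. Assumption A: $D\subset\mathbb R^n$ is a bounded domain; $h:D\to\mathbb R$ is real-analytic; the frequency map $\omega=\partial_yh$ is a global diffeomorphism of $D$ onto $\Omega=\omega(D)\subseteq B_M(0)$, where $M:=\sup_D|\omega|$, with Lipschitz constants $L,\bar L>0$ such that $\bar L^{-1}|y-y_0|\le|\omega(y)-\omega(y_0)|\le L|y-y_0|$ for all $y,y_0\in D$. A resonance is a relation $\omega(y)\cdot k=0$ with $k\in\mathbb Z^n\setminus\{0\}$. It is simple where exactly one independent such relation holds; resonances of order two or more are the points $y\in D$ at which at least two linearly independent such relations hold. The expression "neighbourhood of a simple resonance" in (ii) is descriptive; the neighbourhoods used are $$D^{1,k}=\Big\{y\in D:\ |\omega(y)\cdot k|<\alpha,\ |\mathtt p_k^\perp\omega(y)|<M,\ |\mathtt p_k^\perp\omega(y)\cdot\ell|>\tfrac{3\alpha K_2}{|k|}\ \ \forall\,\ell\in\mathcal G^n_{1,K_2}\setminus\mathbb Zk\Big\},$$ where $\mathtt p_k^\perp\omega=\omega-\frac{\omega\cdot k}{|k|^2}k$ is the orthogonal projection onto the subspace perpendicular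 to $k$. *)

theory Defs
  imports "HOL-Analysis.Analysis"
begin

text \<open>The indices \<open>1, \<dots>, n\<close> are the elements of a finite linearly ordered type \<open>'n\<close>; the order
  gives meaning to ``first nonzero component''.\<close>

definition rvec :: "int ^ 'n \<Rightarrow> real ^ 'n"
  where "rvec k = (\<chi> i. real_of_int (k $ i))"

definition norm1 :: "int ^ 'n \<Rightarrow> int"
  where "norm1 k = (\<Sum>i\<in>UNIV. \<bar>k $ i\<bar>)"

definition Zstar :: "(int ^ 'n::{finite,linorder}) set"
  where "Zstar = {k. k \<noteq> 0 \<and> (\<exists>i. 0 < k $ i \<and> (\<forall>j<i. k $ j = 0))}"

definition gens :: "(int ^ 'n::{finite,linorder}) set"
  where "gens = {k \<in> Zstar. (GCD i\<in>UNIV. k $ i) = 1}"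

definition gens_upto :: "real \<Rightarrow> (int ^ 'n::{finite,linorder}) set"
  where "gens_upto K = {k \<in> gens. real_of_int (norm1 k) \<le> K}"

definition Zspan :: "int ^ 'n \<Rightarrow> (int ^ 'n) set"
  where "Zspan k = range (\<lambda>j::int. j *s k)"

text \<open>Local expansion in an absolutely convergent multivariate power series; multi-indices are
  functions \<open>'n \<Rightarrow> nat\<close>. The set \<open>S\<close> is necessarily open.\<close>

definition real_analytic_on :: "(real ^ 'n \<Rightarrow> real) \<Rightarrow> (real ^ 'n) set \<Rightarrow> bool"
  where "real_analytic_on f S \<longleftrightarrow>
    (\<forall>y0\<in>S. \<exists>r>0. \<exists>a :: ('n \<Rightarrow> nat) \<Rightarrow> real. ball y0 r \<subseteq> S \<and>
      (\<forall>y\<in>ball y0 r. ((\<lambda>m. a m * (\<Prod>i\<in>UNIV. (y $ i - y0 $ i) ^ m i)) has_sum f y) UNIV))"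

definition C1_on :: "('a::real_normed_vector \<Rightarrow> 'b::real_normed_vector) \<Rightarrow> 'a set \<Rightarrow> bool"
  where "C1_on f S \<longleftrightarrow>
    (\<exists>f' :: 'a \<Rightarrow> 'a \<Rightarrow>\<^sub>L 'b. (\<forall>x\<in>S. (f has_derivative blinfun_apply (f' x)) (at x)) \<and> continuous_on S f')"

text \<open>Diffeomorphisms of class \<open>C\<^sup>1\<close> between open sets. For a real-analytic map the inverse is then
  real-analytic as well, so no generality is lost below by not asking for more smoothness.\<close>

definition diffeomorphism_onto ::
    "('a::real_normed_vector \<Rightarrow> 'b::real_normed_vector) \<Rightarrow> 'a set \<Rightarrow> 'b set \<Rightarrow> bool"
  where "diffeomorphism_onto f S T \<longleftrightarrow>
    open S \<and> open T \<and> bij_betw f S T \<and> C1_on f S \<and> C1_on (inv_into S f) T"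

text \<open>The supremum is finite under \<open>assumption_A\<close>, since there \<open>\<omega>\<close> is Lipschitz and \<open>D\<close> bounded and
  nonempty.\<close>

definition sup_freq :: "(real ^ 'n) set \<Rightarrow> (real ^ 'n \<Rightarrow> real ^ 'n) \<Rightarrow> real"
  where "sup_freq D \<omega> = (SUP y\<in>D. norm (\<omega> y))"

definition assumption_A ::
    "(real ^ 'n) set \<Rightarrow> (real ^ 'n \<Rightarrow> real) \<Rightarrow> (real ^ 'n \<Rightarrow> real ^ 'n) \<Rightarrow> real \<Rightarrow> real \<Rightarrow> bool"
  where "assumption_A D h \<omega> L Lbar \<longleftrightarrow>
    open D \<and> connected D \<and> D \<noteq> {} \<and> bounded D \<and>
    real_analytic_on h D \<and>
    (\<forall>y\<in>D. GDERIV h y :> \<omega> y) \<and>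
    diffeomorphism_onto \<omega> D (\<omega> ` D) \<and>
    \<omega> ` D \<subseteq> ball 0 (sup_freq D \<omega>) \<and>
    0 < L \<and> 0 < Lbar \<and>
    (\<forall>y\<in>D. \<forall>y0\<in>D. inverse Lbar * norm (y - y0) \<le> norm (\<omega> y - \<omega> y0) \<and>
                   norm (\<omega> y - \<omega> y0) \<le> L * norm (y - y0))"

definition nonresonant_mod ::
    "(real ^ 'n \<Rightarrow> real ^ 'n) \<Rightarrow> real \<Rightarrow> real \<Rightarrow> (int ^ 'n) set \<Rightarrow> (real ^ 'n) set \<Rightarrow> bool"
  where "nonresonant_mod \<omega> a K \<Lambda> S \<longleftrightarrow>
    (\<forall>y\<in>S. \<forall>l. l \<notin> \<Lambda> \<and> real_of_int (norm1 l) \<le> K \<longrightarrow> \<bar>\<omega> y \<bullet> rvec l\<bar> \<ge> a)"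

definition multiple_resonances :: "(real ^ 'n) set \<Rightarrow> (real ^ 'n \<Rightarrow> real ^ 'n) \<Rightarrow> (real ^ 'n) set"
  where "multiple_resonances D \<omega> =
    {y \<in> D. \<exists>k l. k \<noteq> l \<and> independent {rvec k, rvec l} \<and> \<omega> y \<bullet> rvec k = 0 \<and> \<omega> y \<bullet> rvec l = 0}"

definition proj_perp :: "int ^ 'n \<Rightarrow> real ^ 'n \<Rightarrow> real ^ 'n"
  where "proj_perp k v = v - ((v \<bullet> rvec k) / (norm (rvec k))\<^sup>2) *\<^sub>R rvec k"

definition simple_res_nbhd ::
    "(real ^ 'n::{finite,linorder}) set \<Rightarrow>
      (real ^ 'n::{finite,linorder} \<Rightarrow> real ^ 'n::{finite,linorder}) \<Rightarrow> real \<Rightarrow> real \<Rightarrow>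
      int ^ 'n::{finite,linorder} \<Rightarrow> (real ^ 'n::{finite,linorder}) set"
  where "simple_res_nbhd D \<omega> \<alpha> K2 k =
    {y \<in> D. \<bar>\<omega> y \<bullet> rvec k\<bar> < \<alpha> \<and> norm (proj_perp k (\<omega> y)) < sup_freq D \<omega> \<and>
      (\<forall>l \<in> gens_upto K2 - Zspan k.
         \<bar>proj_perp k (\<omega> y) \<bullet> rvec l\<bar> > 3 * \<alpha> * K2 / norm (rvec k))}"

end

theory Submission
  imports Defs
begin

text \<open>Take for \<open>D0\<close> the points with \<open>|\<omega> \<bullet> k| \<ge> \<alpha> / 2\<close> for all generators \<open>k\<close> up to \<open>K1\<close>. A point outside
  \<open>D0\<close> is \<open>\<alpha>\<close>-close to the resonance of some such \<open>k\<close>. Either it lies in the neighbourhood of that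
  simple resonance, or some generator \<open>l\<close> up to \<open>K2\<close>, not a multiple of \<open>k\<close>, violates the condition
  defining the neighbourhood; the set of these exceptional points is \<open>double_res_zone\<close>. The set \<open>D2\<close>
  is the union of these zones and of all exact multiple resonances. The latter are contained in countably
  many exact resonances, which are null sets (\<open>negligible_multiple_resonances\<close>). Non-resonance in the
  simple neighbourhoods follows by splitting \<open>\<omega> \<bullet> l\<close> along \<open>k\<close> and orthogonally to \<open>k\<close>
  (\<open>simple_res_nbhd_nonresonant\<close>).

  The content is the measure of \<open>D2\<close>. In frequency space the zone of \<open>(k, l)\<close> is contained in a
  rectangular box of half-sides \<open>\<alpha> / |k|\<close> along \<open>k\<close>, \<open>3 \<alpha> K2 / (|k| |l'|)\<close> along the component \<open>l'\<close> of
  \<open>l\<close> orthogonal to \<open>k\<close>, and \<open>M\<close> in the remaining \<open>n - 2\<close> directions. Here \<open>|k| |l'|\<close> is the area of the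
  parallelogram of two independent integer vectors and is therefore at least \<open>1\<close>
  (\<open>one_le_norm_times_norm_proj_perp\<close>). Pulling the box back by \<open>\<omega>\<close> costs a factor of the order of
  \<open>Lbar ^ n\<close> (\<open>measure_preimage_orthogonal_box_le\<close>). It remains to sum over at most \<open>(3 K2) ^ n\<close> vectors
  \<open>l\<close> and, with weight \<open>1 / |k|\<close>, over the \<open>k\<close> (\<open>sum_inverse_norm_norm1_ball_le\<close>).\<close>

section \<open>Preimages of boxes under expanding maps\<close>

lemma orthonormal_basis_extension:
  fixes S :: "'a::euclidean_space set"
  assumes orth: "pairwise orthogonal S" and unit: "\<And>x. x \<in> S \<Longrightarrow> norm x = 1"
  obtains B where "S \<subseteq> B" "pairwise orthogonal B" "\<And>x. x \<in> B \<Longrightarrow> norm x = 1"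
    "finite B" "card B = DIM('a)" "span B = UNIV"
proof -
  obtain U where U: "U \<inter> insert 0 S = {}" "pairwise orthogonal (S \<union> U)"
      "span (S \<union> U) = span (S \<union> Basis)"
    using orthogonal_extension_strong[OF orth] by blast
  define B where "B = (\<lambda>x. x /\<^sub>R norm x) ` (S \<union> U)"
  have nz: "x \<noteq> 0" if "x \<in> S \<union> U" for x
    using that U(1) unit by fastforce
  have "S \<subseteq> B"
    unfolding B_def using unit by force
  moreover have orthB: "pairwise orthogonal B"
  proof -
    have "orthogonal (x /\<^sub>R norm x) (y /\<^sub>R norm y)" if "x \<in> S \<union> U" "y \<in> S \<union> U" "x \<noteq> y" for x y
      using pairwiseD[OF U(2) that] by (simp add: orthogonal_def)
    then show ?thesis
      unfolding B_def pairwise_def by (metis (no_types, lifting) imageE)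
  qed
  moreover have unitB: "norm x = 1" if "x \<in> B" for x
    using that nz unfolding B_def by auto
  moreover have ind: "independent B"
    by (rule pairwise_orthogonal_independent[OF orthB]) (use unitB in force)
  moreover have spanB: "span B = UNIV"
  proof -
    have "x \<in> span B" if "x \<in> S \<union> U" for x
    proof -
      have "norm x *\<^sub>R (x /\<^sub>R norm x) \<in> span B"
        using that unfolding B_def by (intro span_mul span_base) auto
      then show ?thesis using nz[OF that] by simp
    qed
    then have "span (S \<union> U) \<subseteq> span B"
      by (intro span_minimal) auto
    moreover have "UNIV = span (Basis::'a set)" by simp
    moreover have "span (Basis::'a set) \<subseteq> span (S \<union> Basis)" by (intro span_mono) auto
    ultimately show ?thesis using U(3) by auto
  qed
  moreover have "card B = DIM('a)"
    using dim_eq_card_independent[OF ind] dim_span[of B] spanB by simp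
  moreover have "finite B" using ind by (rule independent_imp_finite)
  ultimately show thesis using that by blast
qed

lemma norm_le_sum_orthonormal_coordinates:
  fixes x :: "'a::euclidean_space"
  assumes "pairwise orthogonal B" "\<And>b. b \<in> B \<Longrightarrow> norm b = 1" "finite B" "span B = UNIV"
  shows "norm x \<le> (\<Sum>b\<in>B. \<bar>x \<bullet> b\<bar>)"
proof -
  have "x = (\<Sum>b\<in>B. (x \<bullet> b) *\<^sub>R b)"
    using orthonormal_basis_expand[of B x] assms by simp
  then have "norm x \<le> (\<Sum>b\<in>B. norm ((x \<bullet> b) *\<^sub>R b))"
    by (metis norm_sum)
  also have "\<dots> = (\<Sum>b\<in>B. \<bar>x \<bullet> b\<bar>)"
    using assms(2) by (intro sum.cong) auto
  finally show ?thesis .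
qed

text \<open>A covering set in place of \<open>E\<close> itself, because the cells to which this is applied need not be
  measurable.\<close>

lemma measurable_cover_of_diameter:
  fixes E :: "'a::euclidean_space set"
  assumes "\<And>x y. x \<in> E \<Longrightarrow> y \<in> E \<Longrightarrow> norm (x - y) \<le> d" and d: "0 \<le> d"
  obtains Q where "E \<subseteq> Q" "Q \<in> lmeasurable" "measure lebesgue Q \<le> (2 * d) ^ DIM('a)"
proof (cases "E = {}")
  case True
  then show thesis using that[of "{}"] d by simp
next
  case False
  then obtain p where p: "p \<in> E" by blast
  show thesis
  proof
    let ?Q = "cbox (p - d *\<^sub>R One) (p + d *\<^sub>R One)"
    show "E \<subseteq> ?Q"
    proof
      fix x assume "x \<in> E"
      have "\<bar>(x - p) \<bullet> b\<bar> \<le> d" if "b \<in> Basis" for b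
        using Basis_le_norm[OF that, of "x - p"] assms(1)[OF \<open>x \<in> E\<close> p] by linarith
      then show "x \<in> ?Q"
        by (fastforce simp: mem_box inner_diff_left inner_add_left abs_le_iff)
    qed
    show "measure lebesgue ?Q \<le> (2 * d) ^ DIM('a)"
      using d by (auto simp: measure_lborel_cbox_eq inner_diff_left inner_add_left)
  qed auto
qed

text \<open>A box with half-sides \<open>r b\<close> along an orthonormal basis \<open>B\<close> is cut into cubes whose side \<open>\<delta>\<close> is
  the smallest of the \<open>r b\<close>, so that at most \<open>4 r b / \<delta>\<close> layers are needed in each direction. Points
  with images in the same cube are at distance at most \<open>\<Lambda> n \<delta>\<close>; hence the part of \<open>E\<close> over one cube fits
  in a set of measure \<open>(2 \<Lambda> n \<delta>) ^ n\<close>, and \<open>\<delta>\<close> cancels on summing over the cubes.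

  This replaces the change of variables formula: only the Lipschitz constant of the inverse of \<open>f\<close>
  enters, and since the cubes may be rotated freely, \<open>B\<close> can be adapted to the resonance.\<close>

lemma measure_preimage_orthogonal_box_le:
  fixes E :: "'a::euclidean_space set" and f :: "'a \<Rightarrow> 'a"
  assumes E: "E \<in> lmeasurable"
    and expand: "\<And>x y. x \<in> E \<Longrightarrow> y \<in> E \<Longrightarrow> norm (x - y) \<le> \<Lambda> * norm (f x - f y)"
    and \<Lambda>: "0 \<le> \<Lambda>"
    and B: "pairwise orthogonal B" "\<And>b. b \<in> B \<Longrightarrow> norm b = 1"
      "finite B" "card B = DIM('a)" "span B = UNIV"
    and r: "\<And>b. b \<in> B \<Longrightarrow> 0 < r b"
    and box: "\<And>x b. x \<in> E \<Longrightarrow> b \<in> B \<Longrightarrow> \<bar>f x \<bullet> b\<bar> \<le> r b"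
  shows "measure lebesgue E \<le> (8 * real DIM('a) * \<Lambda>) ^ DIM('a) * (\<Prod>b\<in>B. r b)"
proof -
  let ?n = "DIM('a)"
  have "B \<noteq> {}" using B(4) by auto
  define \<delta> where "\<delta> = Min (r ` B)"
  have \<delta>: "0 < \<delta>" "\<And>b. b \<in> B \<Longrightarrow> \<delta> \<le> r b"
    using r B(3) \<open>B \<noteq> {}\<close> unfolding \<delta>_def by auto
  define Z where "Z b = {\<lfloor>- r b / \<delta>\<rfloor>..\<lfloor>r b / \<delta>\<rfloor>}" for b
  define cell where "cell z = {x \<in> E. \<forall>b\<in>B. \<lfloor>(f x \<bullet> b) / \<delta>\<rfloor> = z b}" for z
  have cardZ: "real (card (Z b)) \<le> 4 * r b / \<delta>" if "b \<in> B" for b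
  proof -
    \<comment> \<open>There are at most \<open>2 r b / \<delta> + 2\<close> layers; the choice of \<open>\<delta>\<close> turns the additive \<open>2\<close> into a factor.\<close>
    have "1 \<le> r b / \<delta>" using \<delta>(1) \<delta>(2)[OF that] by simp
    moreover have "- r b / \<delta> \<le> r b / \<delta>" using \<delta>(1) r[OF that] by (simp add: divide_right_mono)
    then have "\<lfloor>- r b / \<delta>\<rfloor> \<le> \<lfloor>r b / \<delta>\<rfloor>" by (rule floor_mono)
    then have "real (card (Z b)) = real_of_int \<lfloor>r b / \<delta>\<rfloor> - real_of_int \<lfloor>- r b / \<delta>\<rfloor> + 1"
      unfolding Z_def by simp
    moreover have "real_of_int \<lfloor>r b / \<delta>\<rfloor> \<le> r b / \<delta>" "real_of_int \<lfloor>- r b / \<delta>\<rfloor> > - r b / \<delta> - 1"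
      by linarith+
    moreover have "- r b / \<delta> = - (r b / \<delta>)" "4 * r b / \<delta> = 4 * (r b / \<delta>)" by simp_all
    ultimately show ?thesis by linarith
  qed
  have cover: "E \<subseteq> (\<Union>z\<in>Pi\<^sub>E B Z. cell z)"
  proof
    fix x assume x: "x \<in> E"
    define z where "z = (\<lambda>b\<in>B. \<lfloor>(f x \<bullet> b) / \<delta>\<rfloor>)"
    have "\<lfloor>(f x \<bullet> b) / \<delta>\<rfloor> \<in> Z b" if "b \<in> B" for b
    proof -
      have "- r b / \<delta> \<le> (f x \<bullet> b) / \<delta>" "(f x \<bullet> b) / \<delta> \<le> r b / \<delta>"
        using box[OF x that] \<delta>(1) divide_right_mono[of "- r b" "f x \<bullet> b" \<delta>]
        by (auto intro!: divide_right_mono simp: abs_le_iff)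
      then show ?thesis unfolding Z_def by (auto intro: floor_mono)
    qed
    then have "z \<in> Pi\<^sub>E B Z" unfolding z_def by auto
    moreover have "x \<in> cell z" using x unfolding cell_def z_def by auto
    ultimately show "x \<in> (\<Union>z\<in>Pi\<^sub>E B Z. cell z)" by blast
  qed
  have diam: "norm (x - y) \<le> \<Lambda> * (real ?n * \<delta>)" if "x \<in> cell z" "y \<in> cell z" for x y z
  proof -
    have "\<bar>(f x - f y) \<bullet> b\<bar> \<le> \<delta>" if b: "b \<in> B" for b
    proof -
      have "\<lfloor>(f x \<bullet> b) / \<delta>\<rfloor> = \<lfloor>(f y \<bullet> b) / \<delta>\<rfloor>"
        using \<open>x \<in> cell z\<close> \<open>y \<in> cell z\<close> b unfolding cell_def by simp
      then have "\<bar>(f x \<bullet> b) / \<delta> - (f y \<bullet> b) / \<delta>\<bar> \<le> 1" by linarith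
      then have "\<bar>(f x - f y) \<bullet> b / \<delta>\<bar> \<le> 1"
        by (simp add: inner_diff_left diff_divide_distrib)
      then show ?thesis using \<delta>(1) by (simp add: abs_divide)
    qed
    then have "(\<Sum>b\<in>B. \<bar>(f x - f y) \<bullet> b\<bar>) \<le> real ?n * \<delta>"
      using sum_bounded_above[of B "\<lambda>b. \<bar>(f x - f y) \<bullet> b\<bar>" \<delta>] B(4) by simp
    then have "norm (f x - f y) \<le> real ?n * \<delta>"
      using norm_le_sum_orthonormal_coordinates[OF B(1,2,3,5), of "f x - f y"] by linarith
    then have "\<Lambda> * norm (f x - f y) \<le> \<Lambda> * (real ?n * \<delta>)"
      using \<Lambda> by (rule mult_left_mono)
    moreover have "norm (x - y) \<le> \<Lambda> * norm (f x - f y)"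
      using that expand unfolding cell_def by blast
    ultimately show ?thesis by linarith
  qed
  define \<mu> where "\<mu> = (2 * (\<Lambda> * (real ?n * \<delta>))) ^ ?n"
  have "\<exists>Q. cell z \<subseteq> Q \<and> Q \<in> lmeasurable \<and> measure lebesgue Q \<le> \<mu>" for z
  proof -
    have "0 \<le> \<Lambda> * (real ?n * \<delta>)" using \<Lambda> \<delta>(1) by simp
    with diam show ?thesis
      unfolding \<mu>_def by (rule measurable_cover_of_diameter) blast+
  qed
  then obtain Q where Q: "\<And>z. cell z \<subseteq> Q z" "\<And>z. Q z \<in> lmeasurable" "\<And>z. measure lebesgue (Q z) \<le> \<mu>"
    by metis
  have finPi: "finite (Pi\<^sub>E B Z)" unfolding Z_def by (intro finite_PiE B(3)) auto
  have "measure lebesgue E \<le> measure lebesgue (\<Union>z\<in>Pi\<^sub>E B Z. Q z)"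
  proof (rule measure_mono_fmeasurable)
    show "E \<subseteq> (\<Union>z\<in>Pi\<^sub>E B Z. Q z)" using cover Q(1) by blast
    show "(\<Union>z\<in>Pi\<^sub>E B Z. Q z) \<in> lmeasurable" using finPi Q(2) by (intro fmeasurable.finite_UN) auto
  qed (use E in auto)
  also have "\<dots> \<le> (\<Sum>z\<in>Pi\<^sub>E B Z. measure lebesgue (Q z))"
    using finPi Q(2) by (intro measure_UNION_le) auto
  also have "\<dots> \<le> (\<Sum>z\<in>Pi\<^sub>E B Z. \<mu>)"
    using Q(3) by (rule sum_mono)
  also have "\<dots> = (\<Prod>b\<in>B. real (card (Z b))) * \<mu>"
    using B(3) by (simp add: card_PiE)
  also have "\<dots> \<le> (\<Prod>b\<in>B. 4 * r b / \<delta>) * \<mu>"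
    using cardZ \<Lambda> \<delta>(1) unfolding \<mu>_def by (intro mult_right_mono prod_mono) auto
  also have "\<dots> = (8 * real ?n * \<Lambda>) ^ ?n * (\<Prod>b\<in>B. r b)"
  proof -
    have "(\<Prod>b\<in>B. 4 * r b / \<delta>) = (\<Prod>b\<in>B. (4 / \<delta>) * r b)" by simp
    also have "\<dots> = (4 / \<delta>) ^ ?n * (\<Prod>b\<in>B. r b)"
      using B(4) by (simp only: prod.distrib prod_constant)
    finally have "(\<Prod>b\<in>B. 4 * r b / \<delta>) * \<mu> = ((4 / \<delta>) ^ ?n * \<mu>) * (\<Prod>b\<in>B. r b)"
      by (simp only: mult_ac)
    moreover have "4 / \<delta> * (2 * (\<Lambda> * (real ?n * \<delta>))) = 8 * real ?n * \<Lambda>"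
      using \<delta>(1) by simp
    then have "(4 / \<delta>) ^ ?n * \<mu> = (8 * real ?n * \<Lambda>) ^ ?n"
      unfolding \<mu>_def by (simp only: power_mult_distrib[symmetric])
    ultimately show ?thesis by simp
  qed
  finally show ?thesis .
qed

section \<open>Integer vectors and generators\<close>

lemma rvec_eq_0_iff [simp]: "rvec k = 0 \<longleftrightarrow> k = 0"
  by (simp add: rvec_def vec_eq_iff)

lemma rvec_0 [simp]: "rvec 0 = 0"
  by simp

lemma rvec_scale: "rvec (j *s k) = of_int j *\<^sub>R rvec k"
  by (simp add: rvec_def vec_eq_iff)

lemma inner_rvec: "rvec k \<bullet> rvec l = of_int (\<Sum>i\<in>UNIV. k $ i * l $ i)"
  by (simp add: rvec_def inner_vec_def)

lemma norm1_scale: "norm1 (j *s k) = \<bar>j\<bar> * norm1 k"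
  by (simp add: norm1_def abs_mult sum_distrib_left)

lemma norm1_nonneg: "0 \<le> norm1 k"
  by (simp add: norm1_def sum_nonneg)

lemma norm_rvec_le_norm1: "norm (rvec k) \<le> of_int (norm1 k)"
  using norm_le_l1_cart[of "rvec k"] by (simp add: rvec_def norm1_def)

lemma abs_component_le_norm1: "\<bar>k $ i\<bar> \<le> norm1 k"
  unfolding norm1_def by (rule member_le_sum) auto

lemma abs_component_le_norm_rvec: "real_of_int \<bar>k $ i\<bar> \<le> norm (rvec k)"
  using component_le_norm_cart[of "rvec k" i] by (simp add: rvec_def)

lemma gens_nonzero: "k \<in> gens \<Longrightarrow> k \<noteq> 0"
  by (simp add: gens_def Zstar_def)

lemma nonzero_is_multiple_of_gen:
  fixes l :: "int ^ 'n::{finite,linorder}"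
  assumes "l \<noteq> 0"
  obtains j k where "k \<in> gens" "j \<noteq> 0" "l = j *s k"
proof -
  define g where "g = (GCD i\<in>UNIV. l $ i)"
  define m where "m = (\<chi> i. l $ i div g)"
  have "g \<noteq> 0"
    using assms by (auto simp: g_def vec_eq_iff)
  have gm: "l $ i = g * m $ i" for i
    by (simp add: m_def g_def)
  have "range (($) l) = (*) g ` range (($) m)"
    using gm by (auto simp: image_image)
  then have "g = \<bar>g * (GCD i\<in>UNIV. m $ i)\<bar>"
    using Gcd_mult[of g "range (($) m)"] by (simp add: g_def)
  moreover have "0 \<le> g" "0 \<le> (GCD i\<in>UNIV. m $ i)" by (simp_all add: g_def)
  ultimately have "g * 1 = g * (GCD i\<in>UNIV. m $ i)" by simp
  then have gcdm: "(GCD i\<in>UNIV. m $ i) = 1"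
    using \<open>g \<noteq> 0\<close> by simp
  have "m \<noteq> 0" using gm assms by (auto simp: vec_eq_iff)
  then have ne: "{i. m $ i \<noteq> 0} \<noteq> {}" by (auto simp: vec_eq_iff)
  define i0 where "i0 = Min {i. m $ i \<noteq> 0}"
  have i0: "m $ i0 \<noteq> 0" "\<And>j. j < i0 \<Longrightarrow> m $ j = 0"
    using Min_in[OF _ ne] Min_le[of "{i. m $ i \<noteq> 0}"] unfolding i0_def by fastforce+
  \<comment> \<open>The sign that makes the first nonzero component positive.\<close>
  define s where "s = sgn (m $ i0)"
  have s: "s * s = 1" "s \<noteq> 0" using i0(1) by (auto simp: s_def sgn_if)
  have "(GCD i\<in>UNIV. (s *s m) $ i) = 1"
    using Gcd_mult[of s "range (($) m)"] gcdm i0(1) by (simp add: image_image s_def)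
  moreover have "0 < (s *s m) $ i0" "\<And>j. j < i0 \<Longrightarrow> (s *s m) $ j = 0"
    using i0 by (auto simp: s_def sgn_if)
  moreover have "s *s m \<noteq> 0" using \<open>m \<noteq> 0\<close> s(2) by (auto simp: vec_eq_iff)
  ultimately have "s *s m \<in> gens" unfolding gens_def Zstar_def by auto
  moreover have "l = (g * s) *s (s *s m)"
    using gm s(1) by (simp add: vec_eq_iff)
  ultimately show thesis using that \<open>g \<noteq> 0\<close> s(2) by (metis mult_eq_0_iff)
qed

lemma norm1_le_norm1_scale:
  assumes "j \<noteq> 0" shows "norm1 k \<le> norm1 (j *s k)"
  using mult_right_mono[of 1 "\<bar>j\<bar>" "norm1 k"] assms norm1_nonneg[of k] by (simp add: norm1_scale)

text \<open>A generator spans a maximal lattice: \<open>q l = p k\<close> with \<open>q = |k|\<^sup>2\<close> and \<open>p = l \<bullet> k\<close>, so \<open>q\<close> divides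
  \<open>gcd (p k\<^sub>1, \<dots>, p k\<^sub>n) = |p|\<close>, and the ratio \<open>p / q\<close> is an integer.\<close>

lemma parallel_to_gen_imp_Zspan:
  assumes k: "k \<in> gens" and par: "rvec l = t *\<^sub>R rvec k"
  shows "l \<in> Zspan k"
proof -
  define q where "q = (\<Sum>i\<in>UNIV. k $ i * k $ i)"
  define p where "p = (\<Sum>i\<in>UNIV. l $ i * k $ i)"
  have rq: "real_of_int q = rvec k \<bullet> rvec k" and rp: "real_of_int p = rvec l \<bullet> rvec k"
    by (simp_all add: q_def p_def inner_rvec)
  have "real_of_int q \<noteq> 0" using gens_nonzero[OF k] by (simp add: rq)
  then have "q \<noteq> 0" by simp
  have tq: "t * real_of_int q = real_of_int p"
    by (simp add: rq rp par)
  have comp: "q * l $ i = p * k $ i" for i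
  proof -
    have "real_of_int (l $ i) = t * real_of_int (k $ i)"
      using arg_cong[OF par, of "\<lambda>v. v $ i"] by (simp add: rvec_def)
    then have "real_of_int (q * l $ i) = real_of_int (p * k $ i)"
      by (simp add: tq[symmetric])
    then show ?thesis by (simp only: of_int_eq_iff)
  qed
  have "q dvd Gcd ((*) p ` range (($) k))"
    by (rule Gcd_greatest) (auto simp: comp[symmetric])
  then have "q dvd p"
    using k unfolding Gcd_mult by (simp add: gens_def)
  then obtain j where "p = q * j" by (auto simp: dvd_def)
  then have "l $ i = j * k $ i" for i using comp[of i] \<open>q \<noteq> 0\<close> by simp
  then have "l = j *s k" by (simp add: vec_eq_iff)
  then show ?thesis by (simp add: Zspan_def)
qed

lemma vec_box_finite_card:
  fixes A :: "'n::finite \<Rightarrow> int set"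
  assumes "\<And>i. finite (A i)"
  shows "finite {k :: int ^ 'n. \<forall>i. k $ i \<in> A i}"
    and "card {k :: int ^ 'n. \<forall>i. k $ i \<in> A i} = (\<Prod>i\<in>UNIV. card (A i))"
proof -
  have bij: "bij_betw vec_nth {k :: int ^ 'n. \<forall>i. k $ i \<in> A i} (Pi\<^sub>E UNIV A)"
    by (intro bij_betwI[of _ _ _ vec_lambda]) (auto simp: PiE_def Pi_def)
  show "finite {k :: int ^ 'n. \<forall>i. k $ i \<in> A i}"
    using bij_betw_finite[OF bij] assms by (simp add: finite_PiE)
  show "card {k :: int ^ 'n. \<forall>i. k $ i \<in> A i} = (\<Prod>i\<in>UNIV. card (A i))"
    using bij_betw_same_card[OF bij] by (simp add: card_PiE)
qed

lemma finite_card_norm1_ball: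
  fixes K :: real
  assumes "1 \<le> K"
  shows "finite {k :: int ^ 'n. k \<noteq> 0 \<and> real_of_int (norm1 k) \<le> K}"
    and "real (card {k :: int ^ 'n. k \<noteq> 0 \<and> real_of_int (norm1 k) \<le> K}) \<le> (3 * K) ^ CARD('n)"
proof -
  define A where "A = {- \<lfloor>K\<rfloor>..\<lfloor>K\<rfloor>}"
  have sub: "{k :: int ^ 'n. k \<noteq> 0 \<and> real_of_int (norm1 k) \<le> K} \<subseteq> {k. \<forall>i. k $ i \<in> A}"
  proof
    fix k :: "int ^ 'n" assume "k \<in> {k. k \<noteq> 0 \<and> real_of_int (norm1 k) \<le> K}"
    then have "norm1 k \<le> \<lfloor>K\<rfloor>" by (simp add: le_floor_iff)
    then have "\<bar>k $ i\<bar> \<le> \<lfloor>K\<rfloor>" for i using abs_component_le_norm1[of k i] by linarith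
    then show "k \<in> {k. \<forall>i. k $ i \<in> A}" by (auto simp: A_def abs_le_iff minus_le_iff)
  qed
  have fin: "finite {k :: int ^ 'n. \<forall>i. k $ i \<in> A}"
    and card: "card {k :: int ^ 'n. \<forall>i. k $ i \<in> A} = card A ^ CARD('n)"
    using vec_box_finite_card[of "\<lambda>_. A"] by (simp_all add: A_def)
  show "finite {k :: int ^ 'n. k \<noteq> 0 \<and> real_of_int (norm1 k) \<le> K}" using fin sub by (rule finite_subset[rotated])
  have "1 \<le> \<lfloor>K\<rfloor>" using assms by (simp add: le_floor_iff)
  then have "real (card A) = 2 * real_of_int \<lfloor>K\<rfloor> + 1" by (simp add: A_def)
  also have "\<dots> \<le> 3 * K" using assms by linarith
  finally have "real (card A) ^ CARD('n) \<le> (3 * K) ^ CARD('n)" by (intro power_mono) auto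
  moreover have "real (card {k :: int ^ 'n. k \<noteq> 0 \<and> real_of_int (norm1 k) \<le> K}) \<le> real (card A) ^ CARD('n)"
    using card_mono[OF fin sub] unfolding card of_nat_power[symmetric] by (simp only: of_nat_le_iff)
  ultimately show "real (card {k :: int ^ 'n. k \<noteq> 0 \<and> real_of_int (norm1 k) \<le> K}) \<le> (3 * K) ^ CARD('n)" by linarith
qed

text \<open>The Euclidean norm dominates the largest \<open>|k\<^sub>i|\<close>, so it suffices to sum over a position \<open>i\<close> of the
  maximum, the value \<open>a = k\<^sub>i\<close>, and the other components, which lie in \<open>[-|a|, |a|]\<close>. For fixed \<open>i\<close>
  and \<open>a\<close> there are at most \<open>(3 |a|) ^ (n - 1)\<close> such vectors, contributing at most \<open>1 / |a|\<close> each. The weight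
  \<open>1 / |k|\<close> thus saves one power of \<open>K\<close> over the plain count of \<open>k\<close>; for \<open>n = 1\<close> a logarithm would appear.\<close>

lemma sum_inverse_norm_norm1_ball_le:
  fixes K :: real
  assumes K: "1 \<le> K" and n: "2 \<le> CARD('n)"
  shows "(\<Sum>k\<in>{k :: int ^ 'n. k \<noteq> 0 \<and> real_of_int (norm1 k) \<le> K}. 1 / norm (rvec k))
    \<le> 2 * real CARD('n) * 3 ^ (CARD('n) - 1) * K ^ (CARD('n) - 1)"
proof -
  let ?n = "CARD('n)"
  define I where "I = {- \<lfloor>K\<rfloor>..\<lfloor>K\<rfloor>} - {0}"
  define F where "F = (\<lambda>(i::'n, a::int). {k :: int ^ 'n. \<forall>j. k $ j \<in> (if j = i then {a} else {-\<bar>a\<bar>..\<bar>a\<bar>})})"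
  have finF: "finite (F (i, a))" for i a
    using vec_box_finite_card(1)[of "\<lambda>j. if j = i then {a} else {-\<bar>a\<bar>..\<bar>a\<bar>}"] by (simp add: F_def)
  have "1 \<le> \<lfloor>K\<rfloor>" using K by (simp add: le_floor_iff)
  have cardI: "real (card I) \<le> 2 * K" "finite I"
  proof -
    have "Suc (card I) = card {- \<lfloor>K\<rfloor>..\<lfloor>K\<rfloor>}"
      unfolding I_def using \<open>1 \<le> \<lfloor>K\<rfloor>\<close> by (intro card_Suc_Diff1) auto
    then have "real (Suc (card I)) = 2 * real_of_int \<lfloor>K\<rfloor> + 1"
      using \<open>1 \<le> \<lfloor>K\<rfloor>\<close> by simp
    then have "real (card I) = 2 * real_of_int \<lfloor>K\<rfloor>" by simp
    then show "real (card I) \<le> 2 * K" by linarith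
  qed (simp add: I_def)
  have cardF: "real (card (F (i, a))) * (1 / real_of_int \<bar>a\<bar>) \<le> 3 ^ (?n - 1) * K ^ (?n - 2)"
    if a: "a \<in> I" for i a
  proof -
    have "a \<noteq> 0" "\<bar>a\<bar> \<le> \<lfloor>K\<rfloor>" using a by (auto simp: I_def)
    then have a1: "1 \<le> real_of_int \<bar>a\<bar>" "real_of_int \<bar>a\<bar> \<le> K"
      by (simp_all add: le_floor_iff)
    have "card (F (i, a)) = (\<Prod>j\<in>UNIV. card (if j = i then {a} else {-\<bar>a\<bar>..\<bar>a\<bar>}))"
      using vec_box_finite_card(2)[of "\<lambda>j. if j = i then {a} else {-\<bar>a\<bar>..\<bar>a\<bar>}"] by (simp add: F_def)
    also have "\<dots> = (\<Prod>j\<in>UNIV - {i}. card {-\<bar>a\<bar>..\<bar>a\<bar>})"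
      by (subst prod.remove[of _ i]) auto
    also have "\<dots> = card {-\<bar>a\<bar>..\<bar>a\<bar>} ^ (?n - 1)" by simp
    finally have "real (card (F (i, a))) = (2 * real_of_int \<bar>a\<bar> + 1) ^ (?n - 1)" by simp
    also have "\<dots> \<le> (3 * real_of_int \<bar>a\<bar>) ^ (?n - 1)"
      using a1 by (intro power_mono) auto
    also have "\<dots> = 3 ^ (?n - 1) * real_of_int \<bar>a\<bar> ^ (?n - 2) * real_of_int \<bar>a\<bar>"
    proof -
      have "?n - 1 = Suc (?n - 2)" using n by simp
      then show ?thesis by (simp add: power_mult_distrib)
    qed
    finally have "real (card (F (i, a))) * (1 / real_of_int \<bar>a\<bar>) \<le> 3 ^ (?n - 1) * real_of_int \<bar>a\<bar> ^ (?n - 2)"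
      using a1 by (simp add: field_simps)
    also have "\<dots> \<le> 3 ^ (?n - 1) * K ^ (?n - 2)"
      using a1 by (intro mult_left_mono power_mono) auto
    finally show ?thesis .
  qed
  have "(\<Sum>k\<in>{k :: int ^ 'n. k \<noteq> 0 \<and> real_of_int (norm1 k) \<le> K}. 1 / norm (rvec k))
      \<le> (\<Sum>(x, k)\<in>Sigma (UNIV \<times> I) F. 1 / real_of_int \<bar>snd x\<bar>)"
  proof (rule sum_le_included[where i = snd])
    show "finite {k :: int ^ 'n. k \<noteq> 0 \<and> real_of_int (norm1 k) \<le> K}" by (rule finite_card_norm1_ball[OF K])
    show "finite (Sigma (UNIV \<times> I) F)" using cardI(2) finF by (intro finite_SigmaI) auto
    show "\<forall>y\<in>Sigma (UNIV \<times> I) F. 0 \<le> (case y of (x, k) \<Rightarrow> 1 / real_of_int \<bar>snd x\<bar>)" by auto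
    show "\<forall>k\<in>{k. k \<noteq> 0 \<and> real_of_int (norm1 k) \<le> K}. \<exists>y\<in>Sigma (UNIV \<times> I) F. snd y = k \<and>
        1 / norm (rvec k) \<le> (case y of (x, k) \<Rightarrow> 1 / real_of_int \<bar>snd x\<bar>)"
    proof
      fix k :: "int ^ 'n" assume k: "k \<in> {k. k \<noteq> 0 \<and> real_of_int (norm1 k) \<le> K}"
      obtain i where i: "\<And>j. \<bar>k $ j\<bar> \<le> \<bar>k $ i\<bar>"
      proof -
        have "Max (range (\<lambda>j. \<bar>k $ j\<bar>)) \<in> range (\<lambda>j. \<bar>k $ j\<bar>)" by (rule Max_in) auto
        then obtain i where "Max (range (\<lambda>j. \<bar>k $ j\<bar>)) = \<bar>k $ i\<bar>" by blast
        then have "\<bar>k $ j\<bar> \<le> \<bar>k $ i\<bar>" for j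
          using Max_ge[of "range (\<lambda>j. \<bar>k $ j\<bar>)" "\<bar>k $ j\<bar>"] by simp
        then show thesis by (rule that)
      qed
      have "k \<noteq> 0" using k by simp
      then have ki: "k $ i \<noteq> 0" using i by (force simp: vec_eq_iff)
      have "norm1 k \<le> \<lfloor>K\<rfloor>" using k by (simp add: le_floor_iff)
      then have "k $ i \<in> I" using abs_component_le_norm1[of k i] ki by (auto simp: I_def)
      moreover have "k \<in> F (i, k $ i)" using i by (auto simp: F_def abs_le_iff minus_le_iff)
      moreover have "1 / norm (rvec k) \<le> 1 / real_of_int \<bar>k $ i\<bar>"
        using abs_component_le_norm_rvec[of k i] ki by (intro divide_left_mono mult_pos_pos) auto
      ultimately show "\<exists>y\<in>Sigma (UNIV \<times> I) F. snd y = k \<and>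
          1 / norm (rvec k) \<le> (case y of (x, k) \<Rightarrow> 1 / real_of_int \<bar>snd x\<bar>)"
        by (intro bexI[of _ "((i, k $ i), k)"]) auto
    qed
  qed
  also have "\<dots> = (\<Sum>x\<in>UNIV \<times> I. real (card (F x)) * (1 / real_of_int \<bar>snd x\<bar>))"
    using cardI(2) finF by (subst sum.Sigma[symmetric]) auto
  also have "\<dots> \<le> (\<Sum>x\<in>(UNIV :: 'n set) \<times> I. 3 ^ (?n - 1) * K ^ (?n - 2))"
    using cardF by (intro sum_mono) auto
  also have "\<dots> = real ?n * real (card I) * (3 ^ (?n - 1) * K ^ (?n - 2))"
    by (simp add: card_cartesian_product)
  also have "\<dots> \<le> real ?n * (2 * K) * (3 ^ (?n - 1) * K ^ (?n - 2))"
    using cardI(1) K by (intro mult_right_mono mult_left_mono) auto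
  also have "\<dots> = 2 * real ?n * 3 ^ (?n - 1) * K ^ (?n - 1)"
  proof -
    have "?n - 1 = Suc (?n - 2)" using n by simp
    then show ?thesis by simp
  qed
  finally show ?thesis .
qed

section \<open>Simple and double resonances\<close>

lemma inner_proj_perp_commute: "proj_perp k v \<bullet> w = v \<bullet> proj_perp k w"
  by (simp add: proj_perp_def inner_diff_left inner_diff_right inner_commute)

lemma inner_proj_perp_self: "proj_perp k v \<bullet> rvec k = 0"
  by (cases "k = 0") (simp_all add: proj_perp_def inner_diff_left power2_norm_eq_inner)

lemma norm_proj_perp_le: "norm (proj_perp k v) \<le> norm v"
proof -
  have "orthogonal (proj_perp k v) (((v \<bullet> rvec k) / (norm (rvec k))\<^sup>2) *\<^sub>R rvec k)"
    by (simp add: orthogonal_def inner_proj_perp_self)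
  from norm_add_Pythagorean[OF this]
  have "(norm v)\<^sup>2 \<ge> (norm (proj_perp k v))\<^sup>2" by (simp add: proj_perp_def)
  then show ?thesis by (rule power2_le_imp_le) simp
qed

text \<open>The product is the area of the parallelogram spanned by \<open>k\<close> and \<open>l\<close>; its square is the Gram
  determinant \<open>|k|\<^sup>2 |l|\<^sup>2 - (k \<bullet> l)\<^sup>2\<close>, a positive integer. This is what keeps nearly parallel resonances
  from producing long intersection zones.\<close>

lemma one_le_norm_times_norm_proj_perp:
  fixes k l :: "int ^ 'n::{finite,linorder}"
  assumes k: "k \<in> gens" and l: "l \<notin> Zspan k"
  shows "1 \<le> norm (rvec k) * norm (proj_perp k (rvec l))"
proof -
  let ?p = "proj_perp k (rvec l)"
  define G where "G = (\<Sum>i\<in>UNIV. k $ i * k $ i) * (\<Sum>i\<in>UNIV. l $ i * l $ i) - (\<Sum>i\<in>UNIV. l $ i * k $ i)\<^sup>2"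
  have k0: "rvec k \<noteq> 0" using gens_nonzero[OF k] by simp
  have "?p \<noteq> 0"
  proof
    assume "?p = 0"
    then have "rvec l = ((rvec l \<bullet> rvec k) / (norm (rvec k))\<^sup>2) *\<^sub>R rvec k"
      by (simp add: proj_perp_def)
    then show False using parallel_to_gen_imp_Zspan[OF k] l by blast
  qed
  have "?p \<bullet> ?p = ?p \<bullet> rvec l"
    using inner_proj_perp_self[of k "rvec l"] by (simp add: proj_perp_def[of k "rvec l"] inner_diff_right)
  also have "\<dots> = rvec l \<bullet> rvec l - (rvec l \<bullet> rvec k)\<^sup>2 / (norm (rvec k))\<^sup>2"
    by (simp add: proj_perp_def inner_diff_left power2_eq_square inner_commute[of "rvec k" "rvec l"])
  finally have "(norm (rvec k))\<^sup>2 * (norm ?p)\<^sup>2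
      = (norm (rvec k))\<^sup>2 * (rvec l \<bullet> rvec l) - (rvec l \<bullet> rvec k)\<^sup>2"
    using k0 by (simp add: power2_norm_eq_inner[of ?p] right_diff_distrib)
  also have "\<dots> = real_of_int G"
    by (simp add: G_def power2_norm_eq_inner inner_rvec)
  finally have G: "(norm (rvec k) * norm ?p)\<^sup>2 = real_of_int G" by (simp add: power_mult_distrib)
  moreover have "0 < norm (rvec k) * norm ?p" using k0 \<open>?p \<noteq> 0\<close> by simp
  ultimately have "0 < real_of_int G" by (metis zero_less_power)
  then have "1\<^sup>2 \<le> (norm (rvec k) * norm ?p)\<^sup>2" unfolding G by simp
  then show ?thesis by (rule power2_le_imp_le) simp
qed

text \<open>It is enough to test generators: an integer vector is an integer multiple of a generator, and
  passing to the generator only decreases both the norm and the small divisor.\<close>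

lemma nonresonant_modI_gens:
  fixes \<omega> :: "real ^ 'n::{finite,linorder} \<Rightarrow> real ^ 'n::{finite,linorder}"
  assumes zero: "0 \<in> \<Lambda>"
    and mult: "\<And>j l. l \<in> \<Lambda> \<Longrightarrow> j *s l \<in> \<Lambda>"
    and gen: "\<And>y l. y \<in> S \<Longrightarrow> l \<in> gens_upto K - \<Lambda> \<Longrightarrow> a \<le> \<bar>\<omega> y \<bullet> rvec l\<bar>"
  shows "nonresonant_mod \<omega> a K \<Lambda> S"
  unfolding nonresonant_mod_def
proof (intro ballI allI impI)
  fix y l assume y: "y \<in> S" and l: "l \<notin> \<Lambda> \<and> real_of_int (norm1 l) \<le> K"
  then have "l \<noteq> 0" using zero by blast
  then obtain j m where jm: "m \<in> gens" "j \<noteq> 0" "l = j *s m"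
    by (rule nonzero_is_multiple_of_gen)
  have "norm1 m \<le> norm1 l" using norm1_le_norm1_scale[OF jm(2)] jm(3) by simp
  then have "m \<in> gens_upto K" using jm(1) l by (simp add: gens_upto_def)
  moreover have "m \<notin> \<Lambda>" using mult jm(3) l by blast
  ultimately have "a \<le> \<bar>\<omega> y \<bullet> rvec m\<bar>" using gen y by blast
  also have "\<dots> \<le> \<bar>\<omega> y \<bullet> rvec l\<bar>"
    using mult_right_mono[of 1 "real_of_int \<bar>j\<bar>" "\<bar>\<omega> y \<bullet> rvec m\<bar>"] jm(2)
    by (simp add: jm(3) rvec_scale abs_mult)
  finally show "a \<le> \<bar>\<omega> y \<bullet> rvec l\<bar>" .
qed

text \<open>The component of \<open>\<omega>\<close> along \<open>k\<close> contributes at most \<open>\<alpha> |l| / |k| \<le> \<alpha> K / |k|\<close> to \<open>\<omega> \<bullet> l\<close>, which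
  explains the loss from \<open>3\<close> in the definition of the neighbourhood to \<open>2\<close> here.\<close>

lemma simple_res_nbhd_nonresonant:
  assumes k: "k \<in> gens"
  shows "nonresonant_mod \<omega> (2 * \<alpha> * K / norm (rvec k)) K (Zspan k) (simple_res_nbhd D \<omega> \<alpha> K k)"
proof (rule nonresonant_modI_gens)
  show "0 \<in> Zspan k" unfolding Zspan_def by (rule range_eqI[of _ _ 0]) (simp add: vec_eq_iff)
  show "j *s l \<in> Zspan k" if "l \<in> Zspan k" for j l
    using that unfolding Zspan_def by (auto simp: vector_smult_assoc)
next
  fix y l
  assume y: "y \<in> simple_res_nbhd D \<omega> \<alpha> K k" and l: "l \<in> gens_upto K - Zspan k"
  let ?w = "\<omega> y" and ?N = "norm (rvec k)"
  have N: "0 < ?N" using gens_nonzero[OF k] by simp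
  have a: "\<bar>?w \<bullet> rvec k\<bar> < \<alpha>" and b: "3 * \<alpha> * K / ?N < \<bar>proj_perp k ?w \<bullet> rvec l\<bar>"
    using y l by (auto simp: simple_res_nbhd_def)
  have "norm (rvec l) \<le> K"
    using norm_rvec_le_norm1[of l] l by (auto simp: gens_upto_def)
  have "\<bar>(?w \<bullet> rvec k) / ?N\<^sup>2 * (rvec k \<bullet> rvec l)\<bar> = \<bar>?w \<bullet> rvec k\<bar> * \<bar>rvec k \<bullet> rvec l\<bar> / ?N\<^sup>2"
    by (simp add: abs_mult)
  also have "\<dots> \<le> \<alpha> * (?N * K) / ?N\<^sup>2"
  proof (intro divide_right_mono mult_mono)
    show "\<bar>rvec k \<bullet> rvec l\<bar> \<le> ?N * K"
      using Cauchy_Schwarz_ineq2[of "rvec k" "rvec l"] mult_left_mono[OF \<open>norm (rvec l) \<le> K\<close>, of ?N]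
      by simp
  qed (use a in auto)
  also have "\<dots> = \<alpha> * K / ?N" using N by (simp add: power2_eq_square)
  finally have c: "\<bar>(?w \<bullet> rvec k) / ?N\<^sup>2 * (rvec k \<bullet> rvec l)\<bar> \<le> \<alpha> * K / ?N" .
  have "?w \<bullet> rvec l = proj_perp k ?w \<bullet> rvec l + (?w \<bullet> rvec k) / ?N\<^sup>2 * (rvec k \<bullet> rvec l)"
    by (simp add: proj_perp_def inner_diff_left)
  moreover have "3 * \<alpha> * K / ?N = 2 * \<alpha> * K / ?N + \<alpha> * K / ?N"
    by (simp add: add_divide_distrib[symmetric])
  ultimately show "2 * \<alpha> * K / ?N \<le> \<bar>?w \<bullet> rvec l\<bar>" using b c by linarith
qed

text \<open>The definition puts no bound on the size of the resonant vectors, so a measure estimate for each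
  pair cannot be summed. But a multiple resonance lies on some exact resonance, the Lipschitz preimage
  of a hyperplane, and there are only countably many of these.\<close>

lemma negligible_multiple_resonances:
  fixes \<omega> :: "real ^ 'n \<Rightarrow> real ^ 'n"
  assumes expand: "\<And>x y. x \<in> D \<Longrightarrow> y \<in> D \<Longrightarrow> norm (x - y) \<le> \<Lambda> * norm (\<omega> x - \<omega> y)"
  shows "negligible (multiple_resonances D \<omega>)"
proof -
  define R where "R k = {y \<in> D. \<omega> y \<bullet> rvec k = 0}" for k
  have inj: "inj_on \<omega> D"
    using expand by (fastforce intro: inj_onI)
  have "negligible (R k)" if "k \<noteq> 0" for k
  proof -
    have "negligible {x. rvec k \<bullet> x = 0}" using that by (intro negligible_hyperplane) simp
    then have "negligible (\<omega> ` R k)"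
      by (rule negligible_subset) (auto simp: R_def inner_commute)
    then have "negligible (inv_into D \<omega> ` \<omega> ` R k)"
    proof (rule negligible_locally_Lipschitz_image[rotated])
      fix v assume v: "v \<in> \<omega> ` R k"
      have "norm (inv_into D \<omega> u - inv_into D \<omega> v) \<le> \<Lambda> * norm (u - v)" if "u \<in> \<omega> ` R k" for u
        using that v expand inj by (auto simp: R_def)
      then show "\<exists>T B. open T \<and> v \<in> T \<and>
          (\<forall>u\<in>\<omega> ` R k \<inter> T. norm (inv_into D \<omega> u - inv_into D \<omega> v) \<le> B * norm (u - v))"
        by (intro exI[of _ UNIV] exI[of _ \<Lambda>]) auto
    qed simp
    moreover have "inv_into D \<omega> ` \<omega> ` R k = R k"
      by (rule inv_into_image_cancel[OF inj]) (auto simp: R_def)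
    ultimately show ?thesis by simp
  qed
  then have "negligible (\<Union>(R ` (- {0})))"
    by (intro negligible_countable_Union) auto
  moreover have "multiple_resonances D \<omega> \<subseteq> \<Union>(R ` (- {0}))"
  proof
    fix y assume "y \<in> multiple_resonances D \<omega>"
    then obtain k l where "y \<in> D" "independent {rvec k, rvec l}" "\<omega> y \<bullet> rvec k = 0"
      by (auto simp: multiple_resonances_def)
    moreover have "rvec k \<noteq> 0"
      using dependent_zero[of "{rvec k, rvec l}"] \<open>independent _\<close> by force
    ultimately show "y \<in> \<Union>(R ` (- {0}))" by (auto simp: R_def)
  qed
  ultimately show ?thesis by (rule negligible_subset)
qed

text \<open>The points close to the resonance \<open>k\<close> that \<open>simple_res_nbhd\<close> excludes on account of \<open>l\<close>.\<close>

definition double_res_zone ::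
    "(real ^ 'n) set \<Rightarrow> (real ^ 'n \<Rightarrow> real ^ 'n) \<Rightarrow> real \<Rightarrow> real \<Rightarrow> int ^ 'n \<Rightarrow> int ^ 'n \<Rightarrow> (real ^ 'n) set"
  where "double_res_zone D \<omega> \<alpha> K k l =
    {y \<in> D. \<bar>\<omega> y \<bullet> rvec k\<bar> < \<alpha> \<and> \<bar>proj_perp k (\<omega> y) \<bullet> rvec l\<bar> \<le> 3 * \<alpha> * K / norm (rvec k)}"

lemma lmeasurable_double_res_zone:
  assumes D: "open D" "bounded D" and cont: "continuous_on D \<omega>"
  shows "double_res_zone D \<omega> \<alpha> K k l \<in> lmeasurable"
proof -
  have "open (D \<inter> (\<lambda>y. \<bar>\<omega> y \<bullet> rvec k\<bar>) -` {..<\<alpha>})"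
    by (intro continuous_open_preimage D(1) continuous_intros cont)
  moreover have "D \<inter> (\<lambda>y. \<bar>\<omega> y \<bullet> rvec k\<bar>) -` {..<\<alpha>} = {y \<in> D. \<bar>\<omega> y \<bullet> rvec k\<bar> < \<alpha>}" by auto
  moreover have "open (D \<inter> (\<lambda>y. \<bar>\<omega> y \<bullet> proj_perp k (rvec l)\<bar>) -` {3 * \<alpha> * K / norm (rvec k)<..})"
    by (intro continuous_open_preimage D(1) continuous_intros cont)
  moreover have "D \<inter> (\<lambda>y. \<bar>\<omega> y \<bullet> proj_perp k (rvec l)\<bar>) -` {3 * \<alpha> * K / norm (rvec k)<..}
      = {y \<in> D. 3 * \<alpha> * K / norm (rvec k) < \<bar>proj_perp k (\<omega> y) \<bullet> rvec l\<bar>}"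
    by (auto simp: inner_proj_perp_commute)
  ultimately have "{y \<in> D. \<bar>\<omega> y \<bullet> rvec k\<bar> < \<alpha>}
      - {y \<in> D. 3 * \<alpha> * K / norm (rvec k) < \<bar>proj_perp k (\<omega> y) \<bullet> rvec l\<bar>} \<in> lmeasurable"
    using D by (intro bounded_set_imp_lmeasurable sets.Diff) (auto intro: bounded_subset simp: borel_open)
  moreover have "double_res_zone D \<omega> \<alpha> K k l = {y \<in> D. \<bar>\<omega> y \<bullet> rvec k\<bar> < \<alpha>}
      - {y \<in> D. 3 * \<alpha> * K / norm (rvec k) < \<bar>proj_perp k (\<omega> y) \<bullet> rvec l\<bar>}"
    by (auto simp: double_res_zone_def)
  ultimately show ?thesis by simp
qed

text \<open>In an orthonormal basis that starts with the directions of \<open>k\<close> and of the part of \<open>l\<close> orthogonal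
  to \<open>k\<close>, the frequencies of the zone lie in a box with two short sides \<open>\<alpha> / |k|\<close> and \<open>3 \<alpha> K\<close>; the
  other sides are bounded by \<open>M\<close>. The product of the short sides gives the factor \<open>\<alpha>\<^sup>2 K / |k|\<close>.\<close>

lemma measure_double_res_zone_le:
  fixes D :: "(real ^ 'n) set"
  assumes n: "2 \<le> CARD('n)" and D: "open D" "bounded D" and cont: "continuous_on D \<omega>"
    and expand: "\<And>x y. x \<in> D \<Longrightarrow> y \<in> D \<Longrightarrow> norm (x - y) \<le> \<Lambda> * norm (\<omega> x - \<omega> y)" "0 \<le> \<Lambda>"
    and M: "\<And>y. y \<in> D \<Longrightarrow> norm (\<omega> y) \<le> M" "0 < M"
    and \<alpha>: "0 < \<alpha>" and K: "0 < K"
    and Np: "1 \<le> norm (rvec k) * norm (proj_perp k (rvec l))"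
  shows "measure lebesgue (double_res_zone D \<omega> \<alpha> K k l)
    \<le> (8 * real CARD('n) * \<Lambda>) ^ CARD('n)
        * (3 * \<alpha>\<^sup>2 * K * M ^ (CARD('n) - 2)) * (1 / norm (rvec k))"
proof -
  let ?E = "double_res_zone D \<omega> \<alpha> K k l" and ?N = "norm (rvec k)" and ?p = "proj_perp k (rvec l)"
  have N: "0 < ?N" using Np by (cases "k = 0") auto
  have p: "0 < norm ?p" using Np by (cases "?p = 0") auto
  define e1 where "e1 = rvec k /\<^sub>R ?N"
  define e2 where "e2 = ?p /\<^sub>R norm ?p"
  have e: "norm e1 = 1" "norm e2 = 1" using N p by (simp_all add: e1_def e2_def)
  have orth: "orthogonal e1 e2"
    using inner_proj_perp_self[of k "rvec l"] by (simp add: e1_def e2_def orthogonal_def inner_commute)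
  have "e1 \<noteq> e2" using orth e by (auto simp: orthogonal_def norm_eq_sqrt_inner)
  have "pairwise orthogonal {e1, e2}" using orth by (auto simp: pairwise_insert orthogonal_commute)
  then obtain B where B: "{e1, e2} \<subseteq> B" "pairwise orthogonal B" "\<And>x. x \<in> B \<Longrightarrow> norm x = 1"
      "finite B" "card B = DIM(real ^ 'n)" "span B = UNIV"
    by (rule orthonormal_basis_extension) (use e in auto)
  define r where "r b = (if b = e1 then \<alpha> / ?N else if b = e2 then 3 * \<alpha> * K else M)" for b
  have r: "0 < r b" for b using \<alpha> K M(2) N by (simp add: r_def)
  have box: "\<bar>\<omega> y \<bullet> b\<bar> \<le> r b" if y: "y \<in> ?E" and b: "b \<in> B" for y b
  proof -
    have yk: "\<bar>\<omega> y \<bullet> rvec k\<bar> < \<alpha>" and yl: "\<bar>\<omega> y \<bullet> ?p\<bar> \<le> 3 * \<alpha> * K / ?N" and yD: "y \<in> D"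
      using y by (auto simp: double_res_zone_def inner_proj_perp_commute)
    consider "b = e1" | "b = e2" | "b \<noteq> e1" "b \<noteq> e2" by blast
    then show ?thesis
    proof cases
      case 1
      then show ?thesis using yk N by (simp add: r_def e1_def field_simps)
    next
      case 2
      \<comment> \<open>Here the lower bound on the area of the parallelogram enters.\<close>
      have "3 * \<alpha> * K / ?N \<le> 3 * \<alpha> * K * norm ?p"
      proof -
        have "3 * \<alpha> * K * 1 \<le> 3 * \<alpha> * K * (?N * norm ?p)"
          using Np \<alpha> K by (intro mult_left_mono) auto
        then show ?thesis using N by (simp add: field_simps)
      qed
      then have "\<bar>\<omega> y \<bullet> ?p\<bar> \<le> 3 * \<alpha> * K * norm ?p" using yl by linarith
      then show ?thesis using 2 \<open>e1 \<noteq> e2\<close> p by (simp add: r_def e2_def field_simps)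
    next
      case 3
      then show ?thesis
        using Cauchy_Schwarz_ineq2[of "\<omega> y" b] B(3)[OF b] M(1)[OF yD] by (simp add: r_def)
    qed
  qed
  have "measure lebesgue ?E \<le> (8 * real DIM(real ^ 'n) * \<Lambda>) ^ DIM(real ^ 'n) * (\<Prod>b\<in>B. r b)"
  proof (rule measure_preimage_orthogonal_box_le[where f = \<omega>])
    show "?E \<in> lmeasurable" by (rule lmeasurable_double_res_zone[OF D cont])
    show "norm (x - y) \<le> \<Lambda> * norm (\<omega> x - \<omega> y)" if "x \<in> ?E" "y \<in> ?E" for x y
      using that expand(1) by (auto simp: double_res_zone_def)
  qed (use expand(2) B r box in auto)
  also have "(\<Prod>b\<in>B. r b) = r e1 * (r e2 * (\<Prod>b\<in>B - {e1} - {e2}. r b))"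
    using B(1,4) \<open>e1 \<noteq> e2\<close> by (simp add: prod.remove[of B e1] prod.remove[of "B - {e1}" e2])
  also have "(\<Prod>b\<in>B - {e1} - {e2}. r b) = (\<Prod>b\<in>B - {e1} - {e2}. M)"
    by (rule prod.cong) (auto simp: r_def)
  also have "\<dots> = M ^ (CARD('n) - 2)"
    using B(1,4,5) \<open>e1 \<noteq> e2\<close> by (simp add: card_Diff_singleton_if numeral_2_eq_2)
  finally show ?thesis using \<open>e1 \<noteq> e2\<close> by (simp add: r_def power2_eq_square mult_ac)
qed

section \<open>The covering\<close>

lemma resonant_imp_simple_or_double:
  assumes y: "y \<in> D" and M: "norm (\<omega> y) < sup_freq D \<omega>" and res: "\<bar>\<omega> y \<bullet> rvec k\<bar> < \<alpha>"
  shows "y \<in> simple_res_nbhd D \<omega> \<alpha> K k \<union> (\<Union>l\<in>gens_upto K - Zspan k. double_res_zone D \<omega> \<alpha> K k l)"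
proof (cases "y \<in> simple_res_nbhd D \<omega> \<alpha> K k")
  case False
  have "norm (proj_perp k (\<omega> y)) < sup_freq D \<omega>"
    using norm_proj_perp_le M by (rule le_less_trans)
  with False y res obtain l where l: "l \<in> gens_upto K - Zspan k"
      "\<not> 3 * \<alpha> * K / norm (rvec k) < \<bar>proj_perp k (\<omega> y) \<bullet> rvec l\<bar>"
    unfolding simple_res_nbhd_def by blast
  then have "y \<in> double_res_zone D \<omega> \<alpha> K k l"
    using y res by (simp add: double_res_zone_def)
  then show ?thesis using l(1) by blast
qed simp

text \<open>There are at most \<open>(3 K2) ^ n\<close> choices of \<open>l\<close>, and the factors \<open>1 / |k|\<close> sum to a multiple of
  \<open>K1 ^ (n - 1)\<close>; together with the factor \<open>K2\<close> of a single zone this yields the powers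
  \<open>K2 ^ (n + 1)\<close> and \<open>K1 ^ (n - 1)\<close>.\<close>

lemma measure_double_res_zones_le:
  fixes D :: "(real ^ 'n::{finite,linorder}) set" and K1 K2 :: real
  defines "n \<equiv> CARD('n::{finite,linorder})"
  assumes n: "2 \<le> n" and D: "open D" "bounded D" and cont: "continuous_on D \<omega>"
    and expand: "\<And>x y. x \<in> D \<Longrightarrow> y \<in> D \<Longrightarrow> norm (x - y) \<le> \<Lambda> * norm (\<omega> x - \<omega> y)" "0 \<le> \<Lambda>"
    and M: "\<And>y. y \<in> D \<Longrightarrow> norm (\<omega> y) \<le> M" "0 < M"
    and \<alpha>: "0 < \<alpha>" and K: "1 \<le> K1" "1 \<le> K2"
  defines "Z \<equiv> (\<Union>k\<in>gens_upto K1. \<Union>l\<in>gens_upto K2 - Zspan k. double_res_zone D \<omega> \<alpha> K2 k l)"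
  shows "Z \<in> lmeasurable"
    and "measure lebesgue Z \<le> (8 * real n) ^ n * 3 * 3 ^ n * (2 * real n * 3 ^ (n - 1))
      * \<Lambda> ^ n * M ^ (n - 2) * \<alpha>\<^sup>2 * K2 ^ (n + 1) * K1 ^ (n - 1)"
proof -
  let ?z = "\<lambda>k l. double_res_zone D \<omega> \<alpha> K2 k l"
  have sub: "gens_upto K' \<subseteq> {k :: int ^ 'n::{finite,linorder}. k \<noteq> 0 \<and> real_of_int (norm1 k) \<le> K'}" for K'
    using gens_nonzero by (auto simp: gens_upto_def)
  have fin: "finite (gens_upto K' :: (int ^ 'n::{finite,linorder}) set)" if "1 \<le> K'" for K'
    using sub finite_card_norm1_ball(1)[OF that] by (rule finite_subset)
  have meas: "?z k l \<in> lmeasurable" for k l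
    by (rule lmeasurable_double_res_zone[OF D cont])
  have meask: "(\<Union>l\<in>gens_upto K2 - Zspan k. ?z k l) \<in> lmeasurable" for k
    using fin[OF K(2)] meas by (intro fmeasurable.finite_UN) auto
  show "Z \<in> lmeasurable"
    unfolding Z_def by (intro fmeasurable.finite_UN meask fin K(1))
  define A where "A = (8 * real n * \<Lambda>) ^ n * (3 * \<alpha>\<^sup>2 * K2 * M ^ (n - 2))"
  have A: "0 \<le> A" unfolding A_def using \<alpha> K M(2) expand(2) by (intro mult_nonneg_nonneg) auto
  have card2: "real (card (gens_upto K2 - Zspan k :: (int ^ 'n::{finite,linorder}) set)) \<le> (3 * K2) ^ n" for k
  proof -
    have "card (gens_upto K2 - Zspan k) \<le> card {k :: int ^ 'n::{finite,linorder}. k \<noteq> 0 \<and> real_of_int (norm1 k) \<le> K2}"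
      using sub[of K2] finite_card_norm1_ball(1)[OF K(2)] by (intro card_mono) auto
    then show ?thesis
      using finite_card_norm1_ball(2)[OF K(2), where 'n = 'n] unfolding n_def by linarith
  qed
  have zk: "measure lebesgue (\<Union>l\<in>gens_upto K2 - Zspan k. ?z k l) \<le> (3 * K2) ^ n * A * (1 / norm (rvec k))"
    if k: "k \<in> gens_upto K1" for k
  proof -
    have kg: "k \<in> gens" using k by (simp add: gens_upto_def)
    have "measure lebesgue (\<Union>l\<in>gens_upto K2 - Zspan k. ?z k l)
        \<le> (\<Sum>l\<in>gens_upto K2 - Zspan k. measure lebesgue (?z k l))"
      using fin[OF K(2)] meas by (intro measure_UNION_le) auto
    also have "\<dots> \<le> (\<Sum>l\<in>gens_upto K2 - Zspan k. A * (1 / norm (rvec k)))"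
    proof (rule sum_mono)
      fix l assume "l \<in> gens_upto K2 - Zspan k"
      then have "1 \<le> norm (rvec k) * norm (proj_perp k (rvec l))"
        using one_le_norm_times_norm_proj_perp[OF kg] by blast
      then show "measure lebesgue (?z k l) \<le> A * (1 / norm (rvec k))"
        unfolding A_def n_def
        using n K(2) by (intro measure_double_res_zone_le D cont expand M \<alpha>) (auto simp: n_def)
    qed
    also have "\<dots> = real (card (gens_upto K2 - Zspan k)) * (A * (1 / norm (rvec k)))" by simp
    also have "\<dots> \<le> (3 * K2) ^ n * (A * (1 / norm (rvec k)))"
      using card2 A by (intro mult_right_mono) auto
    finally show ?thesis by (simp only: mult.assoc)
  qed
  have "measure lebesgue Z \<le> (\<Sum>k\<in>gens_upto K1. measure lebesgue (\<Union>l\<in>gens_upto K2 - Zspan k. ?z k l))"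
    unfolding Z_def using fin[OF K(1)] meask by (intro measure_UNION_le) auto
  also have "\<dots> \<le> (\<Sum>k\<in>gens_upto K1. (3 * K2) ^ n * A * (1 / norm (rvec (k :: int ^ 'n::{finite,linorder}))))"
    using zk by (rule sum_mono)
  also have "\<dots> \<le> (\<Sum>k\<in>{k :: int ^ 'n::{finite,linorder}. k \<noteq> 0 \<and> real_of_int (norm1 k) \<le> K1}.
      (3 * K2) ^ n * A * (1 / norm (rvec k)))"
    using sub[of K1] finite_card_norm1_ball(1)[OF K(1)] A K(2) by (intro sum_mono2) auto
  also have "\<dots> = (3 * K2) ^ n * A *
      (\<Sum>k\<in>{k :: int ^ 'n::{finite,linorder}. k \<noteq> 0 \<and> real_of_int (norm1 k) \<le> K1}. 1 / norm (rvec k))"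
    by (simp only: sum_distrib_left)
  also have "\<dots> \<le> (3 * K2) ^ n * A * (2 * real n * 3 ^ (n - 1) * K1 ^ (n - 1))"
    unfolding n_def
    using A K(2) n by (intro mult_left_mono sum_inverse_norm_norm1_ball_le K(1)) (auto simp: n_def)
  also have "\<dots> = (8 * real n) ^ n * 3 * 3 ^ n * (2 * real n * 3 ^ (n - 1))
      * \<Lambda> ^ n * M ^ (n - 2) * \<alpha>\<^sup>2 * K2 ^ (n + 1) * K1 ^ (n - 1)"
    unfolding A_def by (simp only: power_mult_distrib power_add power_one_right mult_ac)
  finally show "measure lebesgue Z \<le> \<dots>" .
qed

theorem proposition2p1:
  assumes "CARD('n::{finite,linorder}) \<ge> 2"
  shows "\<exists>c>0. \<forall>(D :: (real ^ 'n::{finite,linorder}) set) h \<omega> L Lbar (K1::real) (K2::real) (\<alpha>::real).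
    assumption_A D h \<omega> L Lbar \<and> 2 \<le> K1 \<and> K1 \<le> K2 \<and> 0 < \<alpha> \<longrightarrow>
    (\<exists>D0 D1 D2. D = D0 \<union> D1 \<union> D2 \<and>
      nonresonant_mod \<omega> (\<alpha> / 2) K1 {0} D0 \<and>
      D1 = (\<Union>k\<in>gens_upto K1. simple_res_nbhd D \<omega> \<alpha> K2 k) \<and>
      (\<forall>k\<in>gens_upto K1.
         nonresonant_mod \<omega> (2 * \<alpha> * K2 / norm (rvec k)) K2 (Zspan k) (simple_res_nbhd D \<omega> \<alpha> K2 k)) \<and>
      multiple_resonances D \<omega> \<subseteq> D2 \<and>
      D2 \<in> lmeasurable \<and>
      measure lebesgue D2 \<le>
        c * Lbar ^ CARD('n) * sup_freq D \<omega> ^ (CARD('n) - 2) * \<alpha>\<^sup>2 * K2 ^ (CARD('n) + 1) * K1 ^ (CARD('n) - 1))"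
proof (intro exI conjI allI impI)
  let ?n = "CARD('n)"
  show "0 < (8 * real ?n) ^ ?n * 3 * 3 ^ ?n * (2 * real ?n * 3 ^ (?n - 1))"
    by simp
  fix D :: "(real ^ 'n::{finite,linorder}) set" and h \<omega> L Lbar and K1 K2 \<alpha> :: real
  assume asm: "assumption_A D h \<omega> L Lbar \<and> 2 \<le> K1 \<and> K1 \<le> K2 \<and> 0 < \<alpha>"
  define M where "M = sup_freq D \<omega>"
  define D0 where "D0 = {y \<in> D. \<forall>k\<in>gens_upto K1. \<alpha> / 2 \<le> \<bar>\<omega> y \<bullet> rvec k\<bar>}"
  define D1 where "D1 = (\<Union>k\<in>gens_upto K1. simple_res_nbhd D \<omega> \<alpha> K2 k)"
  define Z where "Z = (\<Union>k\<in>gens_upto K1. \<Union>l\<in>gens_upto K2 - Zspan k. double_res_zone D \<omega> \<alpha> K2 k l)"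
  define R where "R = multiple_resonances D \<omega>"
  have A: "open D" "D \<noteq> {}" "bounded D" "diffeomorphism_onto \<omega> D (\<omega> ` D)" "\<omega> ` D \<subseteq> ball 0 M" "0 < Lbar"
    and expand_inv: "\<And>x y. x \<in> D \<Longrightarrow> y \<in> D \<Longrightarrow> inverse Lbar * norm (x - y) \<le> norm (\<omega> x - \<omega> y)"
    and K: "1 \<le> K1" "1 \<le> K2" and \<alpha>: "0 < \<alpha>"
    using asm by (auto simp: assumption_A_def M_def)
  have bound: "norm (\<omega> y) < M" if "y \<in> D" for y
    using A(5) that by auto
  have "0 < M" using A(2) bound norm_ge_zero le_less_trans by blast
  have expand: "norm (x - y) \<le> Lbar * norm (\<omega> x - \<omega> y)" if "x \<in> D" "y \<in> D" for x y
    using expand_inv[OF that] A(6) by (simp add: field_simps)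
  have cont: "continuous_on D \<omega>"
    using A(4) unfolding diffeomorphism_onto_def C1_on_def
    by (meson continuous_at_imp_continuous_on has_derivative_continuous)
  note Z = measure_double_res_zones_le[OF assms A(1,3) cont expand less_imp_le[OF A(6)]
      less_imp_le[OF bound] \<open>0 < M\<close> \<alpha> K, folded Z_def]
  have R: "negligible R"
    unfolding R_def using expand by (rule negligible_multiple_resonances)
  have "D \<subseteq> D0 \<union> D1 \<union> (Z \<union> R)"
  proof
    fix y assume y: "y \<in> D"
    show "y \<in> D0 \<union> D1 \<union> (Z \<union> R)"
    proof (cases "y \<in> D0")
      case False
      then obtain k where k: "k \<in> gens_upto K1" "\<bar>\<omega> y \<bullet> rvec k\<bar> < \<alpha> / 2"
        using y by (auto simp: D0_def not_le)
      then have "\<bar>\<omega> y \<bullet> rvec k\<bar> < \<alpha>" using \<alpha> by linarith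
      from resonant_imp_simple_or_double[OF y bound[OF y, unfolded M_def] this, of K2] k(1)
      show ?thesis unfolding D1_def Z_def by blast
    qed simp
  qed
  moreover have "D0 \<union> D1 \<union> (Z \<union> R) \<subseteq> D"
    by (auto simp: D0_def D1_def Z_def R_def simple_res_nbhd_def double_res_zone_def multiple_resonances_def)
  ultimately show "D = D0 \<union> D1 \<union> (Z \<union> R)" by blast
  show "nonresonant_mod \<omega> (\<alpha> / 2) K1 {0} D0"
    by (rule nonresonant_modI_gens) (auto simp: D0_def)
  show "D1 = (\<Union>k\<in>gens_upto K1. simple_res_nbhd D \<omega> \<alpha> K2 k)" by (rule D1_def)
  show "\<forall>k\<in>gens_upto K1.
      nonresonant_mod \<omega> (2 * \<alpha> * K2 / norm (rvec k)) K2 (Zspan k) (simple_res_nbhd D \<omega> \<alpha> K2 k)"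
    by (auto simp: gens_upto_def intro: simple_res_nbhd_nonresonant)
  show "multiple_resonances D \<omega> \<subseteq> Z \<union> R" by (simp add: R_def)
  show "Z \<union> R \<in> lmeasurable"
    using Z(1) negligible_imp_measurable[OF R] by (rule fmeasurable.Un)
  have "measure lebesgue (Z \<union> R) = measure lebesgue Z"
    using Z(1) R by (intro measure_Un_null_set) (auto simp: negligible_iff_null_sets)
  then show "measure lebesgue (Z \<union> R) \<le> (8 * real ?n) ^ ?n * 3 * 3 ^ ?n * (2 * real ?n * 3 ^ (?n - 1))
      * Lbar ^ ?n * sup_freq D \<omega> ^ (?n - 2) * \<alpha>\<^sup>2 * K2 ^ (?n + 1) * K1 ^ (?n - 1)"
    using Z(2) by (simp only: M_def)
qed

end
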